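(* Let $\Gamma$ be a directed graph. The graph inverse semigroup $I(\Gamma)$ is primitive if and only if $\Gamma$ is totally disconnected or trivial.
   Context: A directed graph $\Gamma$ consists of a non-empty set $\Gamma^0$ of vertices, a possibly empty set $\Gamma^1$ of edges, and source and range maps $s,r:\Gamma^1\to\Gamma^0$. For each edge $e$ there is an inverse (ghost) edge $e^*$ with $s(e^* )=r(e)$ and $r(e^* )=s(e)$; $(\Gamma^1)^*$ is the set of ghost edges. For a vertex $v$, put $s(v)=r(v)=v$. The graph inverse semigroup $I(\Gamma)$ is the semigroup with zero $0$ generated by $\Gamma^0\cup\Gamma^1\cup(\Gamma^1)^*$ subject to the relations: (1) $s(e)e=e=e\,r(e)$ for all $e\in\Gamma^0\cup\Gamma^1\cup(\Gamma^1)^*$; (2) $uv=u$ if $u=v$ and $uv=0$ if $u\neq v$, for all $u,v\in\Gamma^0$; (3) $e^*f=r(e)$ if $e=f$ and $e^*f=0$ if $e\ne f$, for all $e,f\in\Gamma^1$. The zero element is always included in $I(\Gamma)$. $I(\Gamma)$ is an inverse semigroup with zero. The set of idempotents of an inverse semigroup carries the natural partial order: $e\le f$ if and only if $e=ef=fe$. A non-zero idempotent of a semigroup with zero is primitive if it is minimal, relative to the natural partial order, in the set of non-zero idempotents. An inverse semigroup with zero is primitive if every non-zero idempotent is primitive. A directed graph is totally disconnected if it has no edges; it is trivial if it consists of a single vertex and no edges. *)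

theory Defs
  imports "Graph_Theory.Digraph"
begin

section \<open>Inverse semigroups with zero\<close>

locale semigroup_with_zero =
  fixes S :: "'a set"
    and mul :: "'a \<Rightarrow> 'a \<Rightarrow> 'a" (infixl "\<cdot>" 70)
    and zero :: 'a
  assumes mul_closed: "a \<in> S \<Longrightarrow> b \<in> S \<Longrightarrow> a \<cdot> b \<in> S"
    and mul_assoc: "a \<in> S \<Longrightarrow> b \<in> S \<Longrightarrow> c \<in> S \<Longrightarrow> (a \<cdot> b) \<cdot> c = a \<cdot> (b \<cdot> c)"
    and zero_closed: "zero \<in> S"
    and zero_left: "a \<in> S \<Longrightarrow> zero \<cdot> a = zero"
    and zero_right: "a \<in> S \<Longrightarrow> a \<cdot> zero = zero"
begin

definition idempotents :: "'a set" where
  "idempotents = {e \<in> S. e \<cdot> e = e}"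

definition natural_le :: "'a \<Rightarrow> 'a \<Rightarrow> bool" where
  "natural_le e f \<longleftrightarrow> e = e \<cdot> f \<and> e = f \<cdot> e"

definition primitive_idempotent :: "'a \<Rightarrow> bool" where
  "primitive_idempotent e \<longleftrightarrow>
     e \<in> idempotents - {zero} \<and>
     (\<forall>f \<in> idempotents - {zero}. natural_le f e \<longrightarrow> f = e)"

end

locale inverse_semigroup_with_zero = semigroup_with_zero +
  assumes unique_inverse: "a \<in> S \<Longrightarrow> \<exists>!b. b \<in> S \<and> a \<cdot> b \<cdot> a = a \<and> b \<cdot> a \<cdot> b = b"

locale primitive_inverse_semigroup = inverse_semigroup_with_zero +
  assumes primitive: "e \<in> idempotents \<Longrightarrow> e \<noteq> zero \<Longrightarrow> primitive_idempotent e"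


section \<open>Directed graphs\<close>

text \<open>
  \<^locale>\<open>wf_digraph\<close> allows loops, parallel edges and infinite vertex and edge sets,
  but also the graph without vertices, which is excluded here. The source of an edge is its
  \<^const>\<open>tail\<close> and its range is its \<^const>\<open>head\<close>.
\<close>

locale directed_graph = wf_digraph +
  assumes verts_nonempty: "verts G \<noteq> {}"

definition totally_disconnected :: "('v, 'e) pre_digraph \<Rightarrow> bool" where
  "totally_disconnected G \<longleftrightarrow> arcs G = {}"

definition trivial_digraph :: "('v, 'e) pre_digraph \<Rightarrow> bool" where
  "trivial_digraph G \<longleftrightarrow> (\<exists>v. verts G = {v}) \<and> arcs G = {}"


section \<open>The graph inverse semigroup\<close>

datatype ('v, 'e) gen = Vertex 'v | Edge 'e | Ghost 'e

definition gens :: "('v, 'e) pre_digraph \<Rightarrow> ('v, 'e) gen set" where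
  "gens G = Vertex ` verts G \<union> Edge ` arcs G \<union> Ghost ` arcs G"

fun gen_source :: "('v, 'e) pre_digraph \<Rightarrow> ('v, 'e) gen \<Rightarrow> 'v" where
  "gen_source G (Vertex v) = v"
| "gen_source G (Edge e) = tail G e"
| "gen_source G (Ghost e) = head G e"

fun gen_range :: "('v, 'e) pre_digraph \<Rightarrow> ('v, 'e) gen \<Rightarrow> 'v" where
  "gen_range G (Vertex v) = v"
| "gen_range G (Edge e) = head G e"
| "gen_range G (Ghost e) = tail G e"

text \<open>
  The free semigroup with zero on the generators: non-empty words under concatenation, together
  with an adjoined zero \<^term>\<open>None\<close>. Being a semigroup presentation, it has no empty word.
\<close>

type_synonym ('v, 'e) word0 = "('v, 'e) gen list option"

definition words0 :: "('v, 'e) pre_digraph \<Rightarrow> ('v, 'e) word0 set" where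
  "words0 G = insert None (Some ` {w. w \<noteq> [] \<and> set w \<subseteq> gens G})"

fun word_mult :: "('v, 'e) word0 \<Rightarrow> ('v, 'e) word0 \<Rightarrow> ('v, 'e) word0" where
  "word_mult (Some u) (Some w) = Some (u @ w)"
| "word_mult _ _ = None"

inductive_set gis_relations :: "('v, 'e) pre_digraph \<Rightarrow> ('v, 'e) word0 rel"
  for G :: "('v, 'e) pre_digraph" where
  source: "x \<in> gens G \<Longrightarrow> (Some [Vertex (gen_source G x), x], Some [x]) \<in> gis_relations G"
| range: "x \<in> gens G \<Longrightarrow> (Some [x, Vertex (gen_range G x)], Some [x]) \<in> gis_relations G"
| vertex_same: "u \<in> verts G \<Longrightarrow>
    (Some [Vertex u, Vertex u], Some [Vertex u]) \<in> gis_relations G"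
| vertex_diff: "u \<in> verts G \<Longrightarrow> v \<in> verts G \<Longrightarrow> u \<noteq> v \<Longrightarrow>
    (Some [Vertex u, Vertex v], None) \<in> gis_relations G"
| ghost_same: "e \<in> arcs G \<Longrightarrow>
    (Some [Ghost e, Edge e], Some [Vertex (head G e)]) \<in> gis_relations G"
| ghost_diff: "e \<in> arcs G \<Longrightarrow> f \<in> arcs G \<Longrightarrow> e \<noteq> f \<Longrightarrow>
    (Some [Ghost e, Edge f], None) \<in> gis_relations G"

inductive_set gis_cong :: "('v, 'e) pre_digraph \<Rightarrow> ('v, 'e) word0 rel"
  for G :: "('v, 'e) pre_digraph" where
  relation: "(a, b) \<in> gis_relations G \<Longrightarrow> (a, b) \<in> gis_cong G"
| refl: "a \<in> words0 G \<Longrightarrow> (a, a) \<in> gis_cong G"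
| sym: "(a, b) \<in> gis_cong G \<Longrightarrow> (b, a) \<in> gis_cong G"
| trans: "(a, b) \<in> gis_cong G \<Longrightarrow> (b, c) \<in> gis_cong G \<Longrightarrow> (a, c) \<in> gis_cong G"
| mult_left: "(a, b) \<in> gis_cong G \<Longrightarrow> c \<in> words0 G \<Longrightarrow>
    (word_mult c a, word_mult c b) \<in> gis_cong G"
| mult_right: "(a, b) \<in> gis_cong G \<Longrightarrow> c \<in> words0 G \<Longrightarrow>
    (word_mult a c, word_mult b c) \<in> gis_cong G"

definition GIS :: "('v, 'e) pre_digraph \<Rightarrow> ('v, 'e) word0 set set" where
  "GIS G = words0 G // gis_cong G"

definition gis_mult ::
  "('v, 'e) pre_digraph \<Rightarrow> ('v, 'e) word0 set \<Rightarrow> ('v, 'e) word0 set \<Rightarrow> ('v, 'e) word0 set" where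
  "gis_mult G A B = (\<Union>a\<in>A. \<Union>b\<in>B. gis_cong G `` {word_mult a b})"

definition gis_zero :: "('v, 'e) pre_digraph \<Rightarrow> ('v, 'e) word0 set" where
  "gis_zero G = gis_cong G `` {None}"

end

theory Submission
  imports Defs
begin

text \<open>
  Everything hinges on the idempotent \<open>e e\<^sup>*\<close> that an edge \<open>e\<close> produces. It satisfies
  \<open>e e\<^sup>* \<le> s(e)\<close>, so in a primitive semigroup it would have to be \<open>0\<close> or \<open>s(e)\<close>. A
  presentation by itself says only which words are equal, so an invariant is needed to see that
  these three elements differ. It is the action on finite paths (\<open>word0_act\<close>): an edge prepends
  itself to a path, its ghost removes it again, and a vertex is the identity on the paths that
  start there. The defining relations hold for these partial maps, so congruent words act alike
  (\<open>gis_cong_act\<close>). But \<open>e e\<^sup>*\<close> fixes the paths that begin with \<open>e\<close>, whereas it is undefined on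
  the empty path at \<open>s(e)\<close>, which the vertex \<open>s(e)\<close> fixes.

  Without edges, every word multiplies out to a vertex or to \<open>0\<close>, because the relations make
  distinct vertices orthogonal (\<open>GIS_no_arcs\<close>). A semigroup of pairwise orthogonal idempotents is
  primitive for formal reasons (\<open>orthogonal_idempotents_primitive\<close>); in particular this direction
  never has to decide which of the classes are distinct. A trivial graph is just a special
  case of a graph without edges.
\<close>

section \<open>The quotient of the free semigroup with zero\<close>

lemma words0_mult: "a \<in> words0 G \<Longrightarrow> b \<in> words0 G \<Longrightarrow> word_mult a b \<in> words0 G"
  by (auto simp: words0_def)

lemma word_mult_assoc: "word_mult (word_mult a b) c = word_mult a (word_mult b c)"
  by (cases a; cases b; cases c) auto

lemma None_in_words0: "None \<in> words0 G"
  by (simp add: words0_def)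

lemma (in wf_digraph) gis_cong_in_words0:
  assumes "(a, b) \<in> gis_cong G"
  shows "a \<in> words0 G \<and> b \<in> words0 G"
  using assms
proof induction
  case (relation a b)
  then show ?case
    by cases (auto simp: words0_def gens_def)
qed (auto simp: words0_mult)

lemma (in wf_digraph) equiv_gis_cong: "equiv (words0 G) (gis_cong G)"
proof (rule equivI)
  show "gis_cong G \<subseteq> words0 G \<times> words0 G"
    using gis_cong_in_words0 by auto
  show "refl_on (words0 G) (gis_cong G)"
    by (rule refl_onI) (rule gis_cong.refl)
  show "sym (gis_cong G)"
    by (rule symI) (rule gis_cong.sym)
  show "trans (gis_cong G)"
    by (rule transI) (rule gis_cong.trans)
qed

abbreviation gis_class :: "('v, 'e) pre_digraph \<Rightarrow> ('v, 'e) word0 \<Rightarrow> ('v, 'e) word0 set" where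
  "gis_class G a \<equiv> gis_cong G `` {a}"

lemma (in wf_digraph) gis_class_eq_iff:
  assumes "a \<in> words0 G" "b \<in> words0 G"
  shows "gis_class G a = gis_class G b \<longleftrightarrow> (a, b) \<in> gis_cong G"
  using eq_equiv_class_iff[OF equiv_gis_cong assms] .

lemma (in wf_digraph) gis_class_eqI:
  assumes "(a, b) \<in> gis_cong G"
  shows "gis_class G a = gis_class G b"
  using equiv_class_eq[OF equiv_gis_cong assms] .

lemma (in wf_digraph) gis_mult_class:
  assumes "a \<in> words0 G" "b \<in> words0 G"
  shows "gis_mult G (gis_class G a) (gis_class G b) = gis_class G (word_mult a b)"
proof -
  have "gis_class G (word_mult a' b') = gis_class G (word_mult a b)"
    if "(a, a') \<in> gis_cong G" "(b, b') \<in> gis_cong G" for a' b'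
  proof -
    have "(word_mult a b, word_mult a' b) \<in> gis_cong G"
      using that assms by (blast intro: gis_cong.mult_right)
    moreover have "(word_mult a' b, word_mult a' b') \<in> gis_cong G"
      using that gis_cong_in_words0 by (blast intro: gis_cong.mult_left)
    ultimately show ?thesis
      by (metis gis_class_eqI)
  qed
  moreover have "(a, a) \<in> gis_cong G" "(b, b) \<in> gis_cong G"
    using assms by (auto intro: gis_cong.refl)
  ultimately show ?thesis
    unfolding gis_mult_def by blast
qed

lemma gis_class_in_GIS: "a \<in> words0 G \<Longrightarrow> gis_class G a \<in> GIS G"
  unfolding GIS_def by (rule quotientI)

lemma GIS_cases:
  assumes "A \<in> GIS G"
  obtains a where "a \<in> words0 G" "A = gis_class G a"
  using assms unfolding GIS_def by (auto elim: quotientE)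

lemma (in wf_digraph) semigroup_with_zero_GIS:
  "semigroup_with_zero (GIS G) (gis_mult G) (gis_zero G)"
proof
  fix A B assume "A \<in> GIS G" "B \<in> GIS G"
  then show "gis_mult G A B \<in> GIS G"
    by (auto elim!: GIS_cases simp: gis_mult_class words0_mult gis_class_in_GIS)
next
  fix A B C assume "A \<in> GIS G" "B \<in> GIS G" "C \<in> GIS G"
  then show "gis_mult G (gis_mult G A B) C = gis_mult G A (gis_mult G B C)"
    by (auto elim!: GIS_cases simp: gis_mult_class words0_mult word_mult_assoc)
next
  show "gis_zero G \<in> GIS G"
    by (simp add: gis_zero_def gis_class_in_GIS None_in_words0)
next
  fix A assume "A \<in> GIS G"
  then show "gis_mult G (gis_zero G) A = gis_zero G"
    by (auto elim!: GIS_cases simp: gis_zero_def gis_mult_class None_in_words0)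
next
  fix A assume "A \<in> GIS G"
  then show "gis_mult G A (gis_zero G) = gis_zero G"
    by (auto elim!: GIS_cases simp: gis_zero_def gis_mult_class None_in_words0)
qed

section \<open>The action on paths\<close>

text \<open>
  A path is given by its edges and its final vertex; the vertex is what makes an empty path have
  a source. Lists that are no paths are harmless, since the relations hold on them too.
\<close>

fun path_source :: "('v, 'e) pre_digraph \<Rightarrow> 'e list \<times> 'v \<Rightarrow> 'v" where
  "path_source G ([], v) = v"
| "path_source G (e # p, v) = tail G e"

fun gen_act :: "('v, 'e) pre_digraph \<Rightarrow> ('v, 'e) gen \<Rightarrow> 'e list \<times> 'v \<rightharpoonup> 'e list \<times> 'v" where
  "gen_act G (Vertex u) p = (if path_source G p = u then Some p else None)"
| "gen_act G (Edge e) (p, v) = (if path_source G (p, v) = head G e then Some (e # p, v) else None)"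
| "gen_act G (Ghost e) ([], v) = None"
| "gen_act G (Ghost e) (f # p, v) =
     (if f = e \<and> path_source G (p, v) = head G e then Some (p, v) else None)"

fun word_act :: "('v, 'e) pre_digraph \<Rightarrow> ('v, 'e) gen list \<Rightarrow> 'e list \<times> 'v \<rightharpoonup> 'e list \<times> 'v" where
  "word_act G [] = Some"
| "word_act G (x # w) = gen_act G x \<circ>\<^sub>m word_act G w"

fun word0_act :: "('v, 'e) pre_digraph \<Rightarrow> ('v, 'e) word0 \<Rightarrow> 'e list \<times> 'v \<rightharpoonup> 'e list \<times> 'v" where
  "word0_act G None = Map.empty"
| "word0_act G (Some w) = word_act G w"

lemma word_act_append: "word_act G (u @ w) = word_act G u \<circ>\<^sub>m word_act G w"
  by (induction u) (auto simp: map_comp_def fun_eq_iff split: option.splits)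

lemma word0_act_mult: "word0_act G (word_mult a b) = word0_act G a \<circ>\<^sub>m word0_act G b"
  by (cases a; cases b) (auto simp: word_act_append map_comp_def fun_eq_iff split: option.splits)

lemma gis_relations_act:
  assumes "(a, b) \<in> gis_relations G"
  shows "word0_act G a = word0_act G b"
proof
  fix p :: "'b list \<times> 'a"
  obtain es v where p: "p = (es, v)" by (cases p)
  from assms show "word0_act G a p = word0_act G b p"
  proof cases
    case (source x)
    then show ?thesis
      by (cases x; cases es) (auto simp: map_comp_def p)
  next
    case (range x)
    then show ?thesis
      by (cases x; cases es) (auto simp: map_comp_def p)
  qed (auto simp: map_comp_def p)
qed

text \<open>
  The partial maps form a semigroup under composition with the empty map as zero, so it is enough
  that the defining relations hold there.
\<close>

lemma gis_cong_act:
  assumes "(a, b) \<in> gis_cong G"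
  shows "word0_act G a = word0_act G b"
  using assms by induction (auto simp: gis_relations_act word0_act_mult)

section \<open>An edge destroys primitivity\<close>

lemma (in wf_digraph) primitive_GIS_no_arcs:
  assumes "primitive_inverse_semigroup (GIS G) (gis_mult G) (gis_zero G)"
  shows "arcs G = {}"
proof (rule ccontr)
  interpret primitive_inverse_semigroup "GIS G" "gis_mult G" "gis_zero G"
    by fact
  assume "arcs G \<noteq> {}"
  then obtain e where e: "e \<in> arcs G" by blast
  define v where "v = Some [Vertex (tail G e) :: ('a, 'b) gen]"
  define w where "w = Some [Edge e, Ghost e :: ('a, 'b) gen]"
  have v_in: "v \<in> words0 G" and w_in: "w \<in> words0 G"
    using e by (auto simp: v_def w_def words0_def gens_def)
  have gen_words: "Some [Edge e] \<in> words0 G" "Some [Ghost e] \<in> words0 G"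
    using e by (auto simp: words0_def gens_def)
  have vv: "(word_mult v v, v) \<in> gis_cong G"
    using e by (auto simp: v_def intro!: gis_cong.relation gis_relations.vertex_same)
  have vw: "(word_mult v w, w) \<in> gis_cong G"
  proof -
    have "(Some [Vertex (tail G e), Edge e], Some [Edge e]) \<in> gis_cong G"
      using gis_relations.source[of "Edge e" G] e by (auto simp: gens_def intro: gis_cong.relation)
    from gis_cong.mult_right[OF this gen_words(2)] show ?thesis
      by (simp add: v_def w_def)
  qed
  have wv: "(word_mult w v, w) \<in> gis_cong G"
  proof -
    have "(Some [Ghost e, Vertex (tail G e)], Some [Ghost e]) \<in> gis_cong G"
      using gis_relations.range[of "Ghost e" G] e by (auto simp: gens_def intro: gis_cong.relation)
    from gis_cong.mult_left[OF this gen_words(1)] show ?thesis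
      by (simp add: v_def w_def)
  qed
  have ww: "(word_mult w w, w) \<in> gis_cong G"
  proof -
    \<comment> \<open>Cancelling \<open>e\<^sup>* e\<close> in \<open>e e\<^sup>* e e\<^sup>*\<close> leaves the vertex \<open>r(e)\<close>, which \<open>e\<close> then absorbs.\<close>
    have "(Some [Ghost e, Edge e], Some [Vertex (head G e)]) \<in> gis_cong G"
      using e by (auto intro: gis_cong.relation gis_relations.ghost_same)
    from gis_cong.mult_left[OF gis_cong.mult_right[OF this gen_words(2)] gen_words(1)]
    have "(word_mult w w, Some [Edge e, Vertex (head G e), Ghost e]) \<in> gis_cong G"
      by (simp add: w_def)
    moreover have "(Some [Edge e, Vertex (head G e)], Some [Edge e]) \<in> gis_cong G"
      using gis_relations.range[of "Edge e" G] e by (auto simp: gens_def intro: gis_cong.relation)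
    from gis_cong.mult_right[OF this gen_words(2)]
    have "(Some [Edge e, Vertex (head G e), Ghost e], w) \<in> gis_cong G"
      by (simp add: w_def)
    ultimately show ?thesis
      by (rule gis_cong.trans)
  qed
  have not_cong: "(v, None) \<notin> gis_cong G" "(w, None) \<notin> gis_cong G" "(w, v) \<notin> gis_cong G"
  proof -
    \<comment> \<open>The empty path at \<open>s(e)\<close> and the path consisting of \<open>e\<close> tell the three elements apart.\<close>
    have "word0_act G v ([], tail G e) = Some ([], tail G e)"
      "word0_act G w ([], tail G e) = None"
      "word0_act G w ([e], head G e) = Some ([e], head G e)"
      by (auto simp: v_def w_def map_comp_def)
    then show "(v, None) \<notin> gis_cong G" "(w, None) \<notin> gis_cong G" "(w, v) \<notin> gis_cong G"
      by (auto dest!: gis_cong_act)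
  qed
  have nonzero_v: "gis_class G v \<noteq> gis_zero G" and nonzero_w: "gis_class G w \<noteq> gis_zero G"
    and distinct: "gis_class G w \<noteq> gis_class G v"
    using not_cong v_in w_in by (auto simp: gis_zero_def gis_class_eq_iff None_in_words0)
  have idem: "gis_class G v \<in> idempotents" "gis_class G w \<in> idempotents"
    using v_in w_in gis_class_eqI[OF vv] gis_class_eqI[OF ww]
    by (auto simp: idempotents_def gis_class_in_GIS gis_mult_class)
  have "natural_le (gis_class G w) (gis_class G v)"
    using v_in w_in gis_class_eqI[OF vw] gis_class_eqI[OF wv]
    by (simp add: natural_le_def gis_mult_class)
  moreover have "primitive_idempotent (gis_class G v)"
    using idem(1) nonzero_v by (rule primitive)
  ultimately show False
    using idem(2) nonzero_w distinct unfolding primitive_idempotent_def by blast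
qed

section \<open>Graphs without edges\<close>

text \<open>
  If \<open>x\<close> and \<open>y\<close> are different, then \<open>x y = 0\<close>; so neither \<open>x y x = x\<close> nor \<open>x \<le> y\<close> can
  hold with \<open>x \<noteq> 0\<close>. Hence every element is its own only inverse, and nothing but \<open>0\<close> lies
  strictly below another element.
\<close>

lemma (in semigroup_with_zero) orthogonal_idempotents_primitive:
  assumes idem: "\<And>x. x \<in> S \<Longrightarrow> x \<cdot> x = x"
    and orth: "\<And>x y. x \<in> S \<Longrightarrow> y \<in> S \<Longrightarrow> x \<noteq> y \<Longrightarrow> x \<cdot> y = zero"
  shows "primitive_inverse_semigroup S mul zero"
proof
  fix a assume a: "a \<in> S"
  show "\<exists>!b. b \<in> S \<and> a \<cdot> b \<cdot> a = a \<and> b \<cdot> a \<cdot> b = b"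
  proof (rule ex1I)
    show "a \<in> S \<and> a \<cdot> a \<cdot> a = a \<and> a \<cdot> a \<cdot> a = a"
      using a idem by simp
    fix b assume b: "b \<in> S \<and> a \<cdot> b \<cdot> a = a \<and> b \<cdot> a \<cdot> b = b"
    show "b = a"
    proof (rule ccontr)
      assume "b \<noteq> a"
      then have "a \<cdot> b = zero" "b \<cdot> a = zero"
        using a b orth by auto
      then have "a = zero" "b = zero"
        using a b zero_left by auto
      then show False using \<open>b \<noteq> a\<close> by simp
    qed
  qed
next
  fix e assume "e \<in> idempotents" "e \<noteq> zero"
  then show "primitive_idempotent e"
    using orth unfolding primitive_idempotent_def natural_le_def idempotents_def by fastforce
qed

text \<open>
  Multiplying a word out from the right, each step multiplies a vertex by a vertex or by \<open>0\<close>,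
  and the result is again of this form.
\<close>

lemma (in wf_digraph) GIS_no_arcs:
  assumes "arcs G = {}" "A \<in> GIS G"
  shows "A = gis_zero G \<or> (\<exists>v\<in>verts G. A = gis_class G (Some [Vertex v]))"
proof -
  have words: "gis_class G (Some w) = gis_zero G \<or>
      (\<exists>v\<in>verts G. gis_class G (Some w) = gis_class G (Some [Vertex v]))"
    if "w \<noteq> []" "set w \<subseteq> gens G" for w
    using that
  proof (induction w rule: list_nonempty_induct)
    case (single x)
    then show ?case
      using assms(1) by (auto simp: gens_def)
  next
    case (cons x w)
    then obtain u where u: "u \<in> verts G" "x = Vertex u"
      using assms(1) by (auto simp: gens_def)
    have in_words: "Some [x] \<in> words0 G" "Some w \<in> words0 G"
      using cons by (auto simp: words0_def)
    have prod: "gis_class G (Some (x # w)) =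
        gis_mult G (gis_class G (Some [x])) (gis_class G (Some w))"
      using in_words by (simp add: gis_mult_class)
    consider "gis_class G (Some w) = gis_zero G"
      | v where "v \<in> verts G" "gis_class G (Some w) = gis_class G (Some [Vertex v])"
      using cons by auto
    then show ?case
    proof cases
      case 1
      then show ?thesis
        using prod in_words by (simp add: gis_zero_def gis_mult_class None_in_words0)
    next
      case 2
      have "Some [Vertex v] \<in> words0 G"
        using 2(1) by (auto simp: words0_def gens_def)
      then have eq: "gis_class G (Some (x # w)) = gis_class G (Some [Vertex u, Vertex v])"
        using prod 2 u in_words by (simp add: gis_mult_class)
      show ?thesis
      proof (cases "u = v")
        case True
        then show ?thesis
          using eq u gis_class_eqI[OF gis_cong.relation[OF gis_relations.vertex_same]] by auto
      next
        case False
        then show ?thesis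
          using eq u 2(1) gis_class_eqI[OF gis_cong.relation[OF gis_relations.vertex_diff]]
          by (auto simp: gis_zero_def)
      qed
    qed
  qed
  from assms(2) obtain a where a: "a \<in> words0 G" "A = gis_class G a"
    by (rule GIS_cases)
  show ?thesis
  proof (cases a)
    case None
    then show ?thesis using a by (simp add: gis_zero_def)
  next
    case (Some w)
    then show ?thesis using a words[of w] by (auto simp: words0_def)
  qed
qed

lemma (in wf_digraph) no_arcs_primitive_GIS:
  assumes "arcs G = {}"
  shows "primitive_inverse_semigroup (GIS G) (gis_mult G) (gis_zero G)"
proof -
  interpret semigroup_with_zero "GIS G" "gis_mult G" "gis_zero G"
    by (rule semigroup_with_zero_GIS)
  have vertex_mult: "gis_mult G (gis_class G (Some [Vertex u])) (gis_class G (Some [Vertex v])) =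
      (if u = v then gis_class G (Some [Vertex u]) else gis_zero G)"
    if "u \<in> verts G" "v \<in> verts G" for u v
  proof -
    have "Some [Vertex u] \<in> words0 G" "Some [Vertex v] \<in> words0 G"
      using that by (auto simp: words0_def gens_def)
    then show ?thesis
      using that gis_class_eqI[OF gis_cong.relation[OF gis_relations.vertex_same]]
        gis_class_eqI[OF gis_cong.relation[OF gis_relations.vertex_diff]]
      by (auto simp: gis_mult_class gis_zero_def)
  qed
  show ?thesis
  proof (rule orthogonal_idempotents_primitive)
    fix A assume "A \<in> GIS G"
    then show "gis_mult G A A = A"
      using GIS_no_arcs[OF assms, of A] vertex_mult zero_left[OF zero_closed] by auto
  next
    fix A B assume AB: "A \<in> GIS G" "B \<in> GIS G" "A \<noteq> B"
    show "gis_mult G A B = gis_zero G"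
      using GIS_no_arcs[OF assms AB(1)] GIS_no_arcs[OF assms AB(2)] AB(3)
        zero_left[OF AB(2)] zero_right[OF AB(1)] vertex_mult
      by metis
  qed
qed

theorem theorem3:
  fixes G :: "('v, 'e) pre_digraph"
  assumes "directed_graph G"
  shows "primitive_inverse_semigroup (GIS G) (gis_mult G) (gis_zero G)
           \<longleftrightarrow> totally_disconnected G \<or> trivial_digraph G"
proof -
  interpret directed_graph G by fact
  show ?thesis
    using primitive_GIS_no_arcs no_arcs_primitive_GIS
    by (auto simp: totally_disconnected_def trivial_digraph_def)
qed

end
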